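(* Let $$M=\begin{pmatrix}\tau & 1\\ -\delta & 0\end{pmatrix}$$ with the eigenvalues $$\lambda_{1,2}=\frac{\tau\pm\sqrt{\tau^2-4\delta}}{2}.$$ Then $$M^n=\begin{pmatrix}a_n & a_{n-1}\\ -\delta a_{n-1} & -\delta a_{n-2}\end{pmatrix}\qquad\text{for all } n\in\mathbb{N},$$ where $$a_n=\frac{\lambda_1^{n+1}-\lambda_2^{n+1}}{\lambda_1-\lambda_2}.$$
   Context: Here $\tau$ and $\delta$ are real parameters, equal to the trace and the determinant of the $2\times 2$ matrix $M$; the eigenvalues $\lambda_1,\lambda_2$ (with the $+$ and $-$ sign respectively) may be complex. $\mathbb{N}$ denotes the positive integers, and the formula for $a_n$ is used for all integer indices $n\ge -1$ (so that $a_{-1}=0$ and $a_0=1$). *)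

theory Defs
  imports "Jordan_Normal_Form.Spectral_Radius"
begin

definition M_mat :: "real \<Rightarrow> real \<Rightarrow> real mat" where
  "M_mat \<tau> \<delta> = mat_of_rows_list 2 [[\<tau>, 1], [- \<delta>, 0]]"

text \<open>The discriminant may be negative, so the square root is the principal complex one;
  on nonnegative reals it agrees with the usual real square root.\<close>

definition lambda1 :: "real \<Rightarrow> real \<Rightarrow> complex" where
  "lambda1 \<tau> \<delta> = (of_real \<tau> + csqrt (of_real (\<tau>\<^sup>2 - 4 * \<delta>))) / 2"

definition lambda2 :: "real \<Rightarrow> real \<Rightarrow> complex" where
  "lambda2 \<tau> \<delta> = (of_real \<tau> - csqrt (of_real (\<tau>\<^sup>2 - 4 * \<delta>))) / 2"

text \<open>The index is an integer because the value at \<open>-1\<close> is needed. For indices \<open>\<ge> -1\<close> the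
  exponent is nonnegative, so a zero eigenvalue causes no problem. The quotient is meaningful
  only if the two eigenvalues differ; otherwise it is \<open>0\<close> by the convention for division by zero.\<close>

definition a_coeff :: "real \<Rightarrow> real \<Rightarrow> int \<Rightarrow> complex" where
  "a_coeff \<tau> \<delta> n =
     (lambda1 \<tau> \<delta> powi (n + 1) - lambda2 \<tau> \<delta> powi (n + 1)) / (lambda1 \<tau> \<delta> - lambda2 \<tau> \<delta>)"

end

theory Submission
  imports Defs
begin

text \<open>The two numbers have sum \<tau> and product \<delta> (\<open>lambda_sum\<close>,
  \<open>lambda_prod\<close>), so they are the roots of z^2 - \<tau> z + \<delta>, the
  characteristic polynomial of M; this gives the spectrum. Their powers, and hence the a_n, satisfy
  a_(n+2) = \<tau> a_(n+1) - \<delta> a_n (\<open>a_coeff_recurrence\<close>). Right multiplication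
  by M sends a row (x, y) to (\<tau> x - \<delta> y, x), which shifts the row (a_n, a_(n-1)) to
  (a_(n+1), a_n). Both rows of the claimed matrix are of this kind, the second up to the factor
  -\<delta>, so induction from n = 1 with a_(-1) = 0 and a_0 = 1 gives the powers
  (\<open>map_mat_M_mat_pow\<close>). All takes place over the complex numbers, where the
  eigenvalues lie.\<close>

lemma lambda_sum: "lambda1 \<tau> \<delta> + lambda2 \<tau> \<delta> = of_real \<tau>"
  by (simp add: lambda1_def lambda2_def field_simps)

lemma lambda_prod: "lambda1 \<tau> \<delta> * lambda2 \<tau> \<delta> = of_real \<delta>"
proof -
  have "lambda1 \<tau> \<delta> * lambda2 \<tau> \<delta> =
      ((of_real \<tau>)\<^sup>2 - (csqrt (of_real (\<tau>\<^sup>2 - 4 * \<delta>)))\<^sup>2) / 4"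
    by (simp add: lambda1_def lambda2_def power2_eq_square algebra_simps del: power2_csqrt)
  then show ?thesis
    by simp
qed

lemma mat_of_rows_list_2_mult:
  fixes a b c d :: "'a :: comm_ring_1"
  shows "mat_of_rows_list 2 [[a, b], [c, d]] * mat_of_rows_list 2 [[a', b'], [c', d']] =
    mat_of_rows_list 2 [[a * a' + b * c', a * b' + b * d'], [c * a' + d * c', c * b' + d * d']]"
  by (rule eq_matI)
    (auto simp: mat_of_rows_list_def scalar_prod_def less_Suc_eq numeral_2_eq_2)

text \<open>Kept general in the ring because it is applied to the matrix with polynomial entries
  whose determinant is the characteristic polynomial.\<close>

lemma det_mat_2:
  fixes A :: "'a :: comm_ring_1 mat"
  assumes "A \<in> carrier_mat 2 2"
  shows "det A = A $$ (0, 0) * A $$ (1, 1) - A $$ (0, 1) * A $$ (1, 0)"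
  using assms
  by (subst laplace_expansion_row [of _ 2 0])
    (auto simp: numeral_2_eq_2 cofactor_def mat_delete_def det_single)

lemma map_mat_M_mat:
  "map_mat complex_of_real (M_mat \<tau> \<delta>) =
    mat_of_rows_list 2 [[of_real \<tau>, 1], [- of_real \<delta>, 0]]"
  by (rule eq_matI) (auto simp: M_mat_def mat_of_rows_list_def less_Suc_eq numeral_2_eq_2)

lemma M_mat_carrier [simp]: "M_mat \<tau> \<delta> \<in> carrier_mat 2 2"
  by (simp add: M_mat_def mat_of_rows_list_def numeral_2_eq_2)

lemma spectrum_M_mat:
  "spectrum (map_mat complex_of_real (M_mat \<tau> \<delta>)) = {lambda1 \<tau> \<delta>, lambda2 \<tau> \<delta>}"
proof -
  let ?A = "map_mat complex_of_real (M_mat \<tau> \<delta>)"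
  have A: "?A \<in> carrier_mat 2 2"
    by simp
  have "poly (char_poly ?A) z = (z - lambda1 \<tau> \<delta>) * (z - lambda2 \<tau> \<delta>)" for z
  proof -
    have "poly (char_poly ?A) z = z * z - of_real \<tau> * z + of_real \<delta>"
      unfolding char_poly_def
      by (subst det_mat_2) (auto simp: map_mat_M_mat mat_of_rows_list_def char_poly_matrix_def algebra_simps)
    then show ?thesis
      by (simp add: lambda_sum [of \<tau> \<delta>, symmetric] lambda_prod [of \<tau> \<delta>, symmetric] algebra_simps)
  qed
  then show ?thesis
    by (auto simp: spectrum_def eigenvalue_root_char_poly [OF A])
qed

text \<open>Once \<tau> and \<delta> are replaced by the sum and the product of the eigenvalues, the
  mixed terms cancel. The bound on \<open>n\<close> makes every exponent a natural number, which
  keeps a zero eigenvalue harmless.\<close>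

lemma a_coeff_recurrence:
  assumes "n \<ge> - 1"
  shows "a_coeff \<tau> \<delta> (n + 2) = of_real \<tau> * a_coeff \<tau> \<delta> (n + 1) - of_real \<delta> * a_coeff \<tau> \<delta> n"
proof -
  obtain k where k: "n + 1 = int k"
    using assms by (metis add_increasing2 diff_ge_0_iff_ge diff_minus_eq_add nonneg_int_cases)
  have exps: "n + 1 + 1 = int (Suc k)" "n + 2 + 1 = int (Suc (Suc k))"
    using k by simp_all
  show ?thesis
    unfolding a_coeff_def exps unfolding k power_int_of_nat
    unfolding lambda_sum [of \<tau> \<delta>, symmetric] lambda_prod [of \<tau> \<delta>, symmetric]
    by (simp add: diff_divide_distrib [symmetric] algebra_simps)
qed

text \<open>The exponent starts at 1: for exponent 0 the corner entry would involve a_(-2), that is,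
  inverses of the eigenvalues.\<close>

lemma map_mat_M_mat_pow:
  assumes "lambda1 \<tau> \<delta> \<noteq> lambda2 \<tau> \<delta>"
  shows "map_mat complex_of_real (M_mat \<tau> \<delta> ^\<^sub>m Suc m) =
    mat_of_rows_list 2
      [[a_coeff \<tau> \<delta> (int (Suc m)), a_coeff \<tau> \<delta> (int (Suc m) - 1)],
       [- of_real \<delta> * a_coeff \<tau> \<delta> (int (Suc m) - 1), - of_real \<delta> * a_coeff \<tau> \<delta> (int (Suc m) - 2)]]"
proof (induction m)
  case 0
  \<comment> \<open>Distinctness enters here: a_0 is the quotient of the eigenvalue difference by
    itself.\<close>
  have "a_coeff \<tau> \<delta> (- 1) = 0" "a_coeff \<tau> \<delta> 0 = 1"
    using assms by (auto simp: a_coeff_def)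
  moreover from this have "a_coeff \<tau> \<delta> 1 = of_real \<tau>"
    using a_coeff_recurrence [of "- 1" \<tau> \<delta>] by simp
  ultimately show ?case
    by (simp add: map_mat_M_mat)
next
  case (Suc m)
  have "map_mat complex_of_real (M_mat \<tau> \<delta> ^\<^sub>m Suc (Suc m)) =
      map_mat complex_of_real (M_mat \<tau> \<delta> ^\<^sub>m Suc m) * map_mat complex_of_real (M_mat \<tau> \<delta>)"
    unfolding pow_mat.simps(2)[of _ "Suc m"]
    by (rule of_real_hom.mat_hom_mult[of _ 2 2 _ 2]) (auto intro!: pow_carrier_mat mult_carrier_mat[of _ 2 2])
  also have "\<dots> = mat_of_rows_list 2
      [[of_real \<tau> * a_coeff \<tau> \<delta> (int m + 1) - of_real \<delta> * a_coeff \<tau> \<delta> (int m),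
        a_coeff \<tau> \<delta> (int m + 1)],
       [- of_real \<delta> * (of_real \<tau> * a_coeff \<tau> \<delta> (int m) - of_real \<delta> * a_coeff \<tau> \<delta> (int m - 1)),
        - of_real \<delta> * a_coeff \<tau> \<delta> (int m)]]"
    unfolding Suc.IH map_mat_M_mat mat_of_rows_list_2_mult by (simp add: algebra_simps)
  also have "of_real \<tau> * a_coeff \<tau> \<delta> (int m + 1) - of_real \<delta> * a_coeff \<tau> \<delta> (int m) =
      a_coeff \<tau> \<delta> (int m + 2)"
    using a_coeff_recurrence [of "int m" \<tau> \<delta>] by simp
  \<comment> \<open>For \<open>m = 0\<close> this uses the recurrence at -1, the smallest index it
    admits.\<close>
  also have "of_real \<tau> * a_coeff \<tau> \<delta> (int m) - of_real \<delta> * a_coeff \<tau> \<delta> (int m - 1) =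
      a_coeff \<tau> \<delta> (int m + 1)"
    using a_coeff_recurrence [of "int m - 1" \<tau> \<delta>] by (simp add: add.commute)
  finally show ?case
    by (simp add: algebra_simps del: pow_mat.simps)
qed

theorem theoremD1:
  fixes \<tau> \<delta> :: real
  shows "spectrum (map_mat complex_of_real (M_mat \<tau> \<delta>)) = {lambda1 \<tau> \<delta>, lambda2 \<tau> \<delta>} \<and>
    (lambda1 \<tau> \<delta> \<noteq> lambda2 \<tau> \<delta> \<longrightarrow>
      (\<forall>n::nat. n \<ge> 1 \<longrightarrow>
        map_mat complex_of_real (M_mat \<tau> \<delta> ^\<^sub>m n) =
          mat_of_rows_list 2
            [[a_coeff \<tau> \<delta> (int n), a_coeff \<tau> \<delta> (int n - 1)],
             [- of_real \<delta> * a_coeff \<tau> \<delta> (int n - 1), - of_real \<delta> * a_coeff \<tau> \<delta> (int n - 2)]]))"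
proof (intro conjI impI allI)
  show "spectrum (map_mat complex_of_real (M_mat \<tau> \<delta>)) = {lambda1 \<tau> \<delta>, lambda2 \<tau> \<delta>}"
    by (rule spectrum_M_mat)
next
  fix n :: nat
  assume neq: "lambda1 \<tau> \<delta> \<noteq> lambda2 \<tau> \<delta>" and "n \<ge> 1"
  then obtain m where "n = Suc m"
    by (cases n) auto
  with map_mat_M_mat_pow [OF neq, of m]
  show "map_mat complex_of_real (M_mat \<tau> \<delta> ^\<^sub>m n) =
      mat_of_rows_list 2
        [[a_coeff \<tau> \<delta> (int n), a_coeff \<tau> \<delta> (int n - 1)],
         [- of_real \<delta> * a_coeff \<tau> \<delta> (int n - 1), - of_real \<delta> * a_coeff \<tau> \<delta> (int n - 2)]]"
    by simp
qed

end
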